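(* Let $E$ be an $n$-dimensional real vector space, identified with $\mathbb{R}^n$, equipped with an arbitrary norm $\|\cdot\|$. There is a constant $C>0$, depending only on $\|\cdot\|$ and on $n$, such that for every (possibly unbounded) interval $I\subset\mathbb{R}$, every bounded set $\mathbb{D}\subset E$, and every (not necessarily continuous) curve $\theta\colon I\to E$ that is self-contracted with respect to the distance induced by $\|\cdot\|$ and has trace $\theta(I)\subset\mathbb{D}$, one has \[ \ell(\theta)\le C\,\mathrm{diam}\,\mathbb{D}. \]
   Context: A curve is simply a map $\theta\colon I\to E$. It is self-contracted if for all $t_1\le t_2\le t_3$ in $I$ one has $\|\theta(t_3)-\theta(t_2)\|\le\|\theta(t_3)-\theta(t_1)\|$. $|\cdot|$ is the Euclidean norm on $\mathbb{R}^n$, $\mathrm{diam}\,\mathbb{D}$ is the Euclidean diameter of $\mathbb{D}$, and $\ell(\theta)$ is the parametric (Euclidean) length \[ \ell(\theta):=\sup\Big\{\sum_{j=1}^{m-1}|\theta(t_{j+1})-\theta(t_j)|\colon m\in\mathbb{N},\ t_1\le t_2\le\dots\le t_m,\ t_j\in I\Big\}. \] *)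

theory Defs
  imports "HOL-Analysis.Analysis"
begin

(* An arbitrary norm on a real vector space, as a predicate: the type-class operation norm
   on real ^ 'n is the Euclidean norm. *)
definition is_norm :: "('a::real_vector \<Rightarrow> real) \<Rightarrow> bool" where
  "is_norm N \<longleftrightarrow>
     (\<forall>x. 0 \<le> N x) \<and>
     (\<forall>x. N x = 0 \<longleftrightarrow> x = 0) \<and>
     (\<forall>c x. N (c *\<^sub>R x) = \<bar>c\<bar> * N x) \<and>
     (\<forall>x y. N (x + y) \<le> N x + N y)"

(* A curve on I is a total function of which only the values on I matter. *)
definition self_contracted :: "('a::real_vector \<Rightarrow> real) \<Rightarrow> real set \<Rightarrow> (real \<Rightarrow> 'a) \<Rightarrow> bool" where
  "self_contracted N I \<theta> \<longleftrightarrow>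
     (\<forall>t1\<in>I. \<forall>t2\<in>I. \<forall>t3\<in>I. t1 \<le> t2 \<and> t2 \<le> t3 \<longrightarrow>
        N (\<theta> t3 - \<theta> t2) \<le> N (\<theta> t3 - \<theta> t1))"

(* The supremum is taken in the extended nonnegative reals, so it is not presupposed to be
   finite. *)
definition curve_length :: "real set \<Rightarrow> (real \<Rightarrow> 'a::real_normed_vector) \<Rightarrow> ennreal" where
  "curve_length I \<theta> =
     Sup {ennreal (\<Sum>j = 1..<m. norm (\<theta> (t (Suc j)) - \<theta> (t j))) | m (t :: nat \<Rightarrow> real).
            (\<forall>j\<in>{1..m}. t j \<in> I) \<and> mono_on {1..m} t}"

end

theory Submission
  imports Defs
begin

text \<open>
  Colour the nonzero vectors by finitely many colours, so that vectors of one colour have nearly the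
  same direction and nearly the same norming functional. The length of a finite self-contracted
  sequence is bounded by induction on the set \<open>V\<close> of colours of its differences
  \<open>x\<^sub>k - x\<^sub>i\<close> with \<open>i < k\<close>. A block that is much longer than the
  distance of its endpoints shows every colour of \<open>V\<close>, because otherwise the induction
  hypothesis bounds its length. Self-contractedness then forces every direction from such a block to a
  later distant point to be compatible with all of \<open>V\<close>, and these directions lie in an open half
  space: some linear functional \<open>\<phi>\<close> grows at a fixed rate along them.

  Cut the sequence greedily into maximal blocks that are not too long. A block of size \<open>t\<close> has
  all later points at distance at least \<open>2Mt\<close> in the cone where \<open>\<phi>\<close> grows. Points
  after the block are also at distance at least \<open>t/2\<close> from all points before it, hence
  \<open>\<phi>\<close> skips an interval of length comparable to \<open>t\<close> on the starting points of the much
  smaller blocks. The skipped intervals overlap boundedly often, so the sizes sum up to a multiple of the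
  diameter.
\<close>

section \<open>Overlap counting on the line and finite colourings\<close>

text \<open>Integrate the sum of the indicators of the intervals \<open>(l a, u a)\<close>: at every
  \<open>y\<close> it counts the intervals containing \<open>y\<close>, hence is at most
  \<open>P\<close>, and it vanishes outside \<open>[lo, hi]\<close>.\<close>

lemma sum_interval_lengths_le:
  fixes l u :: "'i \<Rightarrow> real"
  assumes fin: "finite S" and sub: "\<And>a. a \<in> S \<Longrightarrow> lo \<le> l a \<and> l a \<le> u a \<and> u a \<le> hi"
    and mult: "\<And>y. card {a \<in> S. l a < y \<and> y < u a} \<le> P" and "lo \<le> hi"
  shows "(\<Sum>a\<in>S. u a - l a) \<le> real P * (hi - lo)"
proof -
  have int: "integrable lborel (indicator {l a<..<u a} :: real \<Rightarrow> real)" if "a \<in> S" for a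
    using sub[OF that] by (intro integrable_real_indicator) auto
  have "(\<Sum>a\<in>S. u a - l a) = (\<Sum>a\<in>S. LINT y|lborel. indicator {l a<..<u a} y)"
    using sub by (intro sum.cong) auto
  also have "\<dots> = (LINT y|lborel. (\<Sum>a\<in>S. indicator {l a<..<u a} y))"
    using int by (subst Bochner_Integration.integral_sum) auto
  also have "\<dots> \<le> (LINT y|lborel. real P * indicator {lo..hi} y)"
  proof (rule integral_mono)
    show "integrable lborel (\<lambda>y. \<Sum>a\<in>S. indicator {l a<..<u a} y :: real)"
      using int by (intro Bochner_Integration.integrable_sum) auto
    show "integrable lborel (\<lambda>y. real P * indicator {lo..hi} y)"
      using \<open>lo \<le> hi\<close> by (intro integrable_mult_right integrable_real_indicator) auto
    fix y :: real
    have eq: "(\<Sum>a\<in>S. indicator {l a<..<u a} y :: real) = card {a \<in> S. l a < y \<and> y < u a}"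
      using fin by (auto simp: indicator_def sum.If_cases Int_def)
    show "(\<Sum>a\<in>S. indicator {l a<..<u a} y) \<le> real P * indicator {lo..hi} y"
    proof (cases "y \<in> {lo..hi}")
      case True
      then show ?thesis using mult[of y] by (simp add: eq)
    next
      case False
      then have "{a \<in> S. l a < y \<and> y < u a} = {}" using sub by force
      then show ?thesis using False by (simp add: eq del: card_eq_0_iff) 
    qed
  qed
  also have "\<dots> = real P * (hi - lo)" using \<open>lo \<le> hi\<close> by simp
  finally show ?thesis .
qed

text \<open>Total boundedness: a point is coloured by a nearby centre of a finite
  \<open>e/2\<close>-net.\<close>

lemma bounded_finite_colouring:
  fixes Z :: "'b::heine_borel set"
  assumes "bounded Z" "0 < e"
  obtains c :: "'b \<Rightarrow> nat" and K where "\<And>z. z \<in> Z \<Longrightarrow> c z < K"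
    and "\<And>z z'. z \<in> Z \<Longrightarrow> z' \<in> Z \<Longrightarrow> c z = c z' \<Longrightarrow> dist z z' < e"
proof -
  have "compact (closure Z)" using assms(1) by (simp add: compact_closure)
  then obtain k where k: "finite k" "closure Z \<subseteq> (\<Union>x\<in>k. ball x (e/2))"
    using assms(2) by (auto simp: compact_eq_totally_bounded dest: spec[of _ "e/2"])
  obtain n and g :: "'b \<Rightarrow> nat" where g: "g ` k = {i. i < n}" "inj_on g k"
    using finite_imp_inj_to_nat_seg[OF k(1)] by blast
  have "\<exists>x\<in>k. dist x z < e/2" if "z \<in> Z" for z
    using that k(2) closure_subset[of Z] by (auto simp: subset_iff)
  then obtain h where h: "\<And>z. z \<in> Z \<Longrightarrow> h z \<in> k \<and> dist (h z) z < e/2" by metis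
  show thesis
  proof (rule that[of "g \<circ> h" n])
    show "(g \<circ> h) z < n" if "z \<in> Z" for z using g h[OF that] by auto
    fix z z' assume z: "z \<in> Z" "z' \<in> Z" "(g \<circ> h) z = (g \<circ> h) z'"
    then have "h z = h z'" using h g(2) by (auto dest: inj_onD)
    then show "dist z z' < e"
      using h[OF z(1)] h[OF z(2)] dist_triangle_half_r[of "h z" z e z'] by simp
  qed
qed

section \<open>Finite self-contracted sequences\<close>

fun path_len :: "('a::real_vector \<Rightarrow> real) \<Rightarrow> 'a list \<Rightarrow> real" where
  "path_len N (x # y # zs) = N (y - x) + path_len N (y # zs)"
| "path_len N _ = 0"

text \<open>The recursion makes heredity under \<open>filter\<close> immediate, and the splitting
  into colour classes relies on it. Equal positions are left out because the inequality is trivial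
  there for a norm; \<open>contractedD\<close> restores them.\<close>

fun contracted :: "('a::real_vector \<Rightarrow> real) \<Rightarrow> 'a list \<Rightarrow> bool" where
  "contracted N [] \<longleftrightarrow> True"
| "contracted N (x # xs) \<longleftrightarrow> sorted_wrt (\<lambda>y z. N (z - y) \<le> N (z - x)) xs \<and> contracted N xs"

lemma path_len_nth: "path_len N xs = (\<Sum>i<length xs - 1. N (xs ! Suc i - xs ! i))"
proof (induction N xs rule: path_len.induct)
  case (1 N x y zs)
  then show ?case by (simp add: sum.lessThan_Suc_shift del: sum.lessThan_Suc)
qed auto

lemma contracted_filter: "contracted N xs \<Longrightarrow> contracted N (filter P xs)"
  by (induction xs) (auto simp: sorted_wrt_filter)

lemma contracted_iff_nth:
  "contracted N xs \<longleftrightarrow>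
    (\<forall>i j k. i < j \<longrightarrow> j < k \<longrightarrow> k < length xs \<longrightarrow> N (xs ! k - xs ! j) \<le> N (xs ! k - xs ! i))"
proof (induction xs)
  case (Cons x xs)
  show ?case (is "_ \<longleftrightarrow> ?R")
  proof
    assume l: "contracted N (x # xs)"
    show ?R
    proof (intro allI impI)
      fix i j k assume *: "i < j" "j < k" "k < length (x # xs)"
      have s: "sorted_wrt (\<lambda>y z. N (z - y) \<le> N (z - x)) xs"
        and c: "\<And>i j k. i < j \<Longrightarrow> j < k \<Longrightarrow> k < length xs \<Longrightarrow> N (xs ! k - xs ! j) \<le> N (xs ! k - xs ! i)"
        using l Cons by simp_all
      have "0 < j" "0 < k" using * by simp_all
      then obtain j' k' where jk: "j = Suc j'" "k = Suc k'" by (auto simp: gr0_conv_Suc)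
      show "N ((x # xs) ! k - (x # xs) ! j) \<le> N ((x # xs) ! k - (x # xs) ! i)"
      proof (cases i)
        case 0
        then show ?thesis using sorted_wrt_nth_less[OF s, of j' k'] * jk by simp
      next
        case (Suc i')
        then show ?thesis using c[of i' j' k'] * jk by simp
      qed
    qed
  next
    assume R: ?R
    have "sorted_wrt (\<lambda>y z. N (z - y) \<le> N (z - x)) xs"
      unfolding sorted_wrt_iff_nth_less
    proof (intro allI impI)
      fix i j assume "i < j" "j < length xs"
      then show "N (xs ! j - xs ! i) \<le> N (xs ! j - x)"
        using R[rule_format, of 0 "Suc i" "Suc j"] by simp
    qed
    moreover have "contracted N xs"
      unfolding Cons
    proof (intro allI impI)
      fix i j k assume "i < j" "j < k" "k < length xs"
      then show "N (xs ! k - xs ! j) \<le> N (xs ! k - xs ! i)"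
        using R[rule_format, of "Suc i" "Suc j" "Suc k"] by simp
    qed
    ultimately show "contracted N (x # xs)" by simp
  qed
qed simp

section \<open>Arbitrary norms: equivalence, norming functionals, packing\<close>

locale vector_norm =
  fixes N :: "'a::euclidean_space \<Rightarrow> real"
  assumes is_norm: "is_norm N"
begin

lemma nonneg [simp]: "0 \<le> N x" and eq_0_iff [simp]: "N x = 0 \<longleftrightarrow> x = 0"
  and scale: "N (c *\<^sub>R x) = \<bar>c\<bar> * N x" and triangle: "N (x + y) \<le> N x + N y"
  using is_norm by (auto simp: is_norm_def)

lemma zero [simp]: "N 0 = 0"
  by simp

lemma pos_iff [simp]: "0 < N x \<longleftrightarrow> x \<noteq> 0"
  using nonneg[of x] by (auto simp: less_le simp del: nonneg)

lemma minus [simp]: "N (- x) = N x"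
  using scale[of "-1" x] by simp

lemma commute: "N (x - y) = N (y - x)"
  using minus[of "x - y"] by simp

lemma triangle_diff: "N (x - z) \<le> N (x - y) + N (y - z)"
  using triangle[of "x - y" "y - z"] by simp

lemma upper_bound: obtains B where "0 < B" "\<And>x. N x \<le> B * norm x"
proof -
  have "N x \<le> (1 + (\<Sum>b\<in>Basis. N b)) * norm x" for x
  proof -
    have sum_le: "N (\<Sum>b\<in>S. (x \<bullet> b) *\<^sub>R b) \<le> (\<Sum>b\<in>S. \<bar>x \<bullet> b\<bar> * N b)" if "finite S" for S
      using that
    proof induction
      case (insert b S)
      then show ?case using triangle[of "(x \<bullet> b) *\<^sub>R b" "\<Sum>b\<in>S. (x \<bullet> b) *\<^sub>R b"] by (simp add: scale)
    qed simp
    have "N x = N (\<Sum>b\<in>Basis. (x \<bullet> b) *\<^sub>R b)" by (simp add: euclidean_representation)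
    also have "\<dots> \<le> (\<Sum>b\<in>Basis. \<bar>x \<bullet> b\<bar> * N b)" by (rule sum_le) simp
    also have "\<dots> \<le> (\<Sum>b\<in>Basis. norm x * N b)"
      by (intro sum_mono mult_right_mono Basis_le_norm) auto
    also have "\<dots> \<le> (1 + (\<Sum>b\<in>Basis. N b)) * norm x"
      unfolding sum_distrib_left[symmetric] by (simp add: algebra_simps)
    finally show ?thesis .
  qed
  moreover have "0 < 1 + (\<Sum>b\<in>Basis. N b)" using sum_nonneg[of Basis N] by simp
  ultimately show thesis using that by blast
qed

text \<open>By \<open>upper_bound\<close>, \<open>N\<close> is Lipschitz for the Euclidean norm, so
  it attains a positive minimum on the compact unit sphere; homogeneity does the rest.\<close>

lemma lower_bound: obtains b where "0 < b" "\<And>x. norm x \<le> b * N x"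
proof -
  obtain B where B: "0 < B" "\<And>x. N x \<le> B * norm x" by (fact upper_bound)
  have "\<bar>N x - N y\<bar> \<le> B * norm (x - y)" for x y
    using triangle_diff[of x 0 y] triangle_diff[of y 0 x] B(2)[of "x - y"] commute[of x y] by simp
  then have "B-lipschitz_on UNIV N"
    using B(1) by (auto simp: lipschitz_on_def dist_norm)
  then have cont: "continuous_on (sphere 0 1) N"
    using lipschitz_on_continuous_on continuous_on_subset by blast
  have ne: "sphere (0::'a) 1 \<noteq> {}" by simp
  obtain s where s: "s \<in> sphere 0 1" "\<And>x. x \<in> sphere 0 1 \<Longrightarrow> N s \<le> N x"
    using continuous_attains_inf[OF compact_sphere ne cont] by auto
  have pos: "0 < N s" using s(1) by auto
  have "norm x \<le> inverse (N s) * N x" for x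
  proof (cases "x = 0")
    case False
    then have "N s \<le> N ((1 / norm x) *\<^sub>R x)" by (intro s(2)) simp
    then show ?thesis using False pos by (simp add: scale field_simps)
  qed simp
  then show thesis using that[of "inverse (N s)"] pos by simp
qed

text \<open>A hyperplane separates \<open>w\<close> from the open \<open>N\<close>-ball of radius
  \<open>N w\<close>; its normal is rescaled to take the value \<open>N w\<close> at
  \<open>w\<close>.\<close>

lemma norming_functional: obtains a where "a \<bullet> w = N w" "\<And>y. a \<bullet> y \<le> N y"
proof (cases "w = 0")
  case True
  then show thesis using that[of 0] by simp
next
  case False
  let ?S = "{y. N y < N w}"
  have "convex ?S"
  proof (rule convexI)
    fix x y u v :: real and p q assume *: "p \<in> ?S" "q \<in> ?S" "0 \<le> u" "0 \<le> v" "u + v = 1"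
    then show "u *\<^sub>R p + v *\<^sub>R q \<in> ?S"
      using triangle[of "u *\<^sub>R p" "v *\<^sub>R q"] convex_bound_lt[of "N p" "N w" "N q" u v]
      by (simp add: scale)
  qed
  moreover have "?S \<noteq> {}" using False by (auto intro!: exI[of _ 0])
  ultimately obtain a b where a: "a \<noteq> 0" "\<And>y. N y < N w \<Longrightarrow> a \<bullet> y \<le> b" "b \<le> a \<bullet> w"
    using separating_hyperplane_sets[of ?S "{w}"] by auto
  have pos: "0 < a \<bullet> w"
  proof -
    \<comment> \<open>With this \<open>s\<close> the vector \<open>s *\<^sub>R a\<close> has norm
      \<open>N w / 2\<close>, so it lies in \<open>?S\<close> and makes \<open>b\<close>
      positive.\<close>
    define s where "s = N w / (2 * N a)"
    have s: "0 < s" using False a(1) by (simp add: s_def)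
    have "N (s *\<^sub>R a) < N w" using False a(1) by (simp add: s_def scale)
    then have "s * (a \<bullet> a) \<le> b" using a(2) by fastforce
    moreover have "0 < s * (a \<bullet> a)" using s a(1) by simp
    ultimately show ?thesis using a(3) by linarith
  qed
  show thesis
  proof (rule that[of "(N w / (a \<bullet> w)) *\<^sub>R a"])
    show "((N w / (a \<bullet> w)) *\<^sub>R a) \<bullet> w = N w" using pos by simp
    fix y
    show "((N w / (a \<bullet> w)) *\<^sub>R a) \<bullet> y \<le> N y"
    proof (cases "y = 0")
      case y: False
      \<comment> \<open>The separation is known on the open ball only, hence the scaling of
        \<open>y\<close> to norm \<open>z * N w\<close> with \<open>z < 1\<close>; the bound for all
        such \<open>z\<close> gives the claim.\<close>
      have "z * (((N w / (a \<bullet> w)) *\<^sub>R a) \<bullet> y) \<le> N y" if z: "0 < z" "z < 1" for z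
      proof -
        have "N ((z * N w / N y) *\<^sub>R y) < N w" using z y False by (simp add: scale)
        then have "a \<bullet> ((z * N w / N y) *\<^sub>R y) \<le> a \<bullet> w" using a(2,3) by fastforce
        then show ?thesis using y pos by (simp add: field_simps)
      qed
      then show ?thesis by (rule field_le_mult_one_interval)
    qed simp
  qed
qed

text \<open>Dividing by \<open>\<tau>\<close> moves the points into one fixed ball, where a fine
  finite colouring takes different values at separated points. Apart from the norm, \<open>P\<close>
  depends on \<open>e\<close> and \<open>r\<close> only, not on the scale.\<close>

lemma packing:
  assumes "0 < e"
  obtains P :: nat where "\<And>\<tau> (I :: 'i set) x. \<lbrakk>0 < \<tau>;
      \<And>a b. a \<in> I \<Longrightarrow> b \<in> I \<Longrightarrow> a \<noteq> b \<Longrightarrow> e * \<tau> \<le> N (x a - x b);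
      \<And>a b. a \<in> I \<Longrightarrow> b \<in> I \<Longrightarrow> N (x a - x b) \<le> r * \<tau>\<rbrakk> \<Longrightarrow> card I \<le> P"
proof -
  obtain b where b: "0 < b" "\<And>x. norm x \<le> b * N x" by (fact lower_bound)
  obtain B where B: "0 < B" "\<And>x. N x \<le> B * norm x" by (fact upper_bound)
  obtain c :: "'a \<Rightarrow> nat" and K where c: "\<And>z. z \<in> cball 0 (b * r) \<Longrightarrow> c z < K"
      "\<And>z z'. z \<in> cball 0 (b * r) \<Longrightarrow> z' \<in> cball 0 (b * r) \<Longrightarrow> c z = c z' \<Longrightarrow> dist z z' < e / B"
    using bounded_finite_colouring[OF bounded_cball divide_pos_pos[OF assms B(1)]] by blast
  show thesis
  proof (rule that[of K])
    fix \<tau> and I :: "'i set" and x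
    assume \<tau>: "0 < \<tau>"
      and sep: "\<And>a b. a \<in> I \<Longrightarrow> b \<in> I \<Longrightarrow> a \<noteq> b \<Longrightarrow> e * \<tau> \<le> N (x a - x b)"
      and bdd: "\<And>a b. a \<in> I \<Longrightarrow> b \<in> I \<Longrightarrow> N (x a - x b) \<le> r * \<tau>"
    show "card I \<le> K"
    proof (cases "I = {}")
      case False
      then obtain o' where o': "o' \<in> I" by blast
      define z where "z a = (1 / \<tau>) *\<^sub>R (x a - x o')" for a
      have z: "z a \<in> cball 0 (b * r)" if "a \<in> I" for a
      proof -
        have "N (z a) \<le> r" using bdd[OF that o'] \<tau> by (simp add: z_def scale divide_le_eq)
        then have "b * N (z a) \<le> b * r" using b(1) by simp
        then show ?thesis using b(2)[of "z a"] by simp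
      qed
      have "inj_on (c \<circ> z) I"
      proof (rule inj_onI, rule ccontr)
        fix a a' assume a: "a \<in> I" "a' \<in> I" "(c \<circ> z) a = (c \<circ> z) a'" "a \<noteq> a'"
        then have "norm (z a - z a') < e / B" using c(2)[OF z z] by (simp add: dist_norm)
        then have "N (z a - z a') < e"
          using B(2)[of "z a - z a'"] B(1) by (simp add: field_simps)
        moreover have "z a - z a' = (1 / \<tau>) *\<^sub>R (x a - x a')"
          by (simp add: z_def scaleR_diff_right[symmetric])
        ultimately have "N (x a - x a') < e * \<tau>" using \<tau> by (simp only: scale) (simp add: divide_less_eq)
        then show False using sep[OF a(1,2,4)] by simp
      qed
      moreover have "(c \<circ> z) ` I \<subseteq> {..<K}" using c(1) z by auto
      ultimately show ?thesis by (metis card_inj_on_le card_lessThan finite_lessThan)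
    qed simp
  qed
qed

section \<open>The charging argument over scales\<close>

text \<open>
  The numbers \<open>t a\<close> are the sizes of consecutive blocks that start at the points \<open>x a\<close>.
\<close>

definition scattered :: "real \<Rightarrow> real \<Rightarrow> real \<Rightarrow> real \<Rightarrow> nat set \<Rightarrow>
    (nat \<Rightarrow> 'a) \<Rightarrow> (nat \<Rightarrow> real) \<Rightarrow> (nat \<Rightarrow> real) \<Rightarrow> bool" where
  "scattered c A M D S x t \<phi> \<longleftrightarrow> finite S \<and> 0 \<le> D \<and> (\<forall>a\<in>S. 0 \<le> t a \<and> t a \<le> D) \<and>
    (\<forall>j\<in>S. \<forall>a\<in>S. \<forall>b\<in>S. j \<le> a \<longrightarrow> a < b \<longrightarrow>
      t a \<le> 2 * N (x b - x j) \<and> N (x b - x a) \<le> N (x b - x j)) \<and>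
    (\<forall>a\<in>S. \<forall>b\<in>S. a < b \<longrightarrow> M * t a \<le> N (x b - x a) \<longrightarrow> c * N (x b - x a) \<le> \<phi> b - \<phi> a) \<and>
    (\<forall>a\<in>S. \<forall>b\<in>S. \<bar>\<phi> b - \<phi> a\<bar> \<le> A * N (x b - x a) \<and> N (x b - x a) \<le> D)"

text \<open>
  The interval \<open>(Y a + \<gamma> t a / 2, Y a + \<gamma> t a)\<close> is charged to \<open>a\<close>. Maximizing
  over \<open>t j \<le> t a\<close> only and subtracting \<open>\<mu> t j\<close> in \<open>Y\<close> makes the charged
  intervals of very different scales disjoint, in either order of time; those of comparable scales meet only
  if the points are close, where packing bounds their number.
\<close>

lemma sum_scales_le:
  fixes x :: "nat \<Rightarrow> 'a" and t \<phi> :: "nat \<Rightarrow> real" and A M c :: real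
  defines "\<mu> \<equiv> 2 * A * M" and "\<gamma> \<equiv> c / 4"
  defines "\<kappa> \<equiv> \<gamma> / \<mu>" and "\<Lambda> \<equiv> M + (\<mu> + \<gamma>) / c"
  assumes c: "0 < c" "c \<le> A" and M: "1 \<le> M" and scattered: "scattered c A M D S x t \<phi>"
    and pack: "\<And>\<tau> I. \<lbrakk>0 < \<tau>;
      \<And>a b. a \<in> I \<Longrightarrow> b \<in> I \<Longrightarrow> a \<noteq> b \<Longrightarrow> \<kappa> / 2 * \<tau> \<le> N (x a - x b);
      \<And>a b. a \<in> I \<Longrightarrow> b \<in> I \<Longrightarrow> N (x a - x b) \<le> \<Lambda> * \<tau>\<rbrakk> \<Longrightarrow> card I \<le> P"
  shows "sum t S \<le> 2 * real P * (2 * A + \<mu> + \<gamma>) / \<gamma> * D"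
proof (cases "S = {}")
  case False
  have fin: "finite S"
    and later: "\<And>j a b. \<lbrakk>j \<in> S; a \<in> S; b \<in> S; j \<le> a; a < b\<rbrakk> \<Longrightarrow>
      t a \<le> 2 * N (x b - x j) \<and> N (x b - x a) \<le> N (x b - x j)"
    and cone: "\<And>a b. \<lbrakk>a \<in> S; b \<in> S; a < b; M * t a \<le> N (x b - x a)\<rbrakk> \<Longrightarrow>
      c * N (x b - x a) \<le> \<phi> b - \<phi> a"
    and lip: "\<And>a b. \<lbrakk>a \<in> S; b \<in> S\<rbrakk> \<Longrightarrow> \<bar>\<phi> b - \<phi> a\<bar> \<le> A * N (x b - x a)"
    and bdd: "\<And>a b. \<lbrakk>a \<in> S; b \<in> S\<rbrakk> \<Longrightarrow> N (x b - x a) \<le> D"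
    and D: "0 \<le> D" and t: "\<And>a. a \<in> S \<Longrightarrow> 0 \<le> t a \<and> t a \<le> D"
    using scattered unfolding scattered_def by blast+
  obtain o' where o': "o' \<in> S" using False by blast
  have pos: "0 < A" "0 < \<gamma>" "0 < \<mu>" "0 < \<kappa>" "0 < \<Lambda>" and \<gamma>A: "4 * \<gamma> \<le> A" and \<mu>\<kappa>: "\<mu> * \<kappa> = \<gamma>"
    using c M by (auto simp: \<gamma>_def \<mu>_def \<kappa>_def \<Lambda>_def add_pos_pos)
  have "A \<le> A * M" using pos(1) M by simp
  then have \<mu>\<gamma>: "8 * \<gamma> \<le> \<mu>" using \<gamma>A by (simp add: \<mu>_def)
  then have \<kappa>: "\<kappa> \<le> 1 / 2" using pos by (simp add: \<kappa>_def field_simps)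
  define Y where "Y a = Max ((\<lambda>j. \<phi> j - \<mu> * t j) ` {j \<in> S. j \<le> a \<and> t j \<le> t a})" for a
  have Y_ge: "\<phi> j - \<mu> * t j \<le> Y a" if "j \<in> S" "j \<le> a" "t j \<le> t a" for a j
    unfolding Y_def using that fin by (intro Max_ge) auto
  have Y_attained: "\<exists>j\<in>S. j \<le> a \<and> t j \<le> t a \<and> Y a = \<phi> j - \<mu> * t j" if "a \<in> S" for a
  proof -
    have "Y a \<in> (\<lambda>j. \<phi> j - \<mu> * t j) ` {j \<in> S. j \<le> a \<and> t j \<le> t a}"
      unfolding Y_def using that fin by (intro Max_in) auto
    then show ?thesis by auto
  qed
  \<comment> \<open>Later values of \<open>\<phi>\<close> fall by at most
    \<open>A * M * t a\<close>: distant points are in the cone, near ones are covered by the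
    Lipschitz bound. As \<open>\<mu> = 2 * A * M\<close>, this is half of the penalty in
    \<open>Y\<close>.\<close>
  have drop: "\<phi> a - A * M * t a \<le> \<phi> b" if "a \<in> S" "b \<in> S" "a < b" for a b
  proof (cases "M * t a \<le> N (x b - x a)")
    case True
    have "0 \<le> c * N (x b - x a)" "0 \<le> A * M * t a" using c pos M t that by auto
    then show ?thesis using cone[OF that True] by linarith
  next
    case False
    then have "A * N (x b - x a) \<le> A * (M * t a)" using pos by (intro mult_left_mono) auto
    then show ?thesis using lip[OF that(1,2)] by (simp add: mult.assoc)
  qed
  have small_after: "Y a + \<gamma> * t a \<le> Y b"
    if ab: "a \<in> S" "b \<in> S" "a < b" and tb: "t b \<le> \<kappa> * t a" for a b
  proof -
    obtain j where j: "j \<in> S" "j \<le> a" "t j \<le> t a" "Y a = \<phi> j - \<mu> * t j"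
      using Y_attained[OF ab(1)] by blast
    have "\<mu> * t b \<le> \<mu> * (\<kappa> * t a)" using tb pos by simp
    then have lb: "\<mu> * t b \<le> \<gamma> * t a" using \<mu>\<kappa> by (simp add: mult.assoc[symmetric])
    have Yb: "\<phi> b - \<mu> * t b \<le> Y b" using ab by (intro Y_ge) auto
    have jb: "j < b" using j ab by simp
    show ?thesis
    \<comment> \<open>If \<open>j\<close> is much smaller than \<open>a\<close>, the distance of at
      least \<open>t a / 2\<close> from \<open>x j\<close> to \<open>x b\<close> lets
      \<open>\<phi>\<close> grow by \<open>2 * \<gamma> * t a\<close>. Otherwise half of the penalty
      \<open>\<mu> * t j\<close> survives the drop and is at least as large. Either way
      \<open>\<gamma> * t a\<close> remains after paying \<open>\<mu> * t b\<close>.\<close>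
    proof (cases "2 * M * t j \<le> t a")
      case True
      have N: "t a \<le> 2 * N (x b - x j)" using later[of j a b] j ab by blast
      then have "M * t j \<le> N (x b - x j)" using True by linarith
      then have "c * N (x b - x j) \<le> \<phi> b - \<phi> j" using cone j ab jb by blast
      moreover have "c * t a \<le> c * (2 * N (x b - x j))" using N c by simp
      moreover have "0 \<le> \<mu> * t j" using t[OF j(1)] pos by simp
      ultimately show ?thesis using Yb lb j(4) by (simp add: \<gamma>_def)
    next
      case False
      have "A * t a \<le> A * (2 * M * t j)" using False pos by simp
      moreover have "4 * \<gamma> * t a \<le> A * t a" using \<gamma>A t[OF ab(1)] by (intro mult_right_mono) auto
      ultimately show ?thesis
        using drop[OF j(1) ab(2) jb] Yb lb j(4) by (simp add: \<mu>_def)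
    qed
  qed
  have Y_mono: "Y b \<le> Y a" if ab: "a \<in> S" "b \<in> S" "b < a" "t b \<le> t a" for a b
  proof -
    obtain j where j: "j \<in> S" "j \<le> b" "t j \<le> t b" "Y b = \<phi> j - \<mu> * t j"
      using Y_attained[OF ab(2)] by blast
    then show ?thesis using Y_ge[of j a] ab by simp
  qed
  \<comment> \<open>In \<open>\<Lambda>\<close> the summand \<open>M\<close> puts \<open>x b\<close>
    in the cone seen from \<open>x j\<close>, and \<open>(\<mu> + \<gamma>) / c\<close> yields a
    growth that pays for \<open>\<mu> * t b\<close> and the gap.\<close>
  have far_after: "Y a + \<gamma> * \<tau> \<le> Y b"
    if ab: "a \<in> S" "b \<in> S" "a < b" and \<tau>: "t a \<le> \<tau>" "t b \<le> \<tau>" "\<Lambda> * \<tau> \<le> N (x b - x a)" for a b \<tau>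
  proof -
    obtain j where j: "j \<in> S" "j \<le> a" "t j \<le> t a" "Y a = \<phi> j - \<mu> * t j"
      using Y_attained[OF ab(1)] by blast
    have \<tau>0: "0 \<le> \<tau>" using t[OF ab(1)] \<tau>(1) by linarith
    have N: "\<Lambda> * \<tau> \<le> N (x b - x j)" using later[of j a b] j ab \<tau>(3) by fastforce
    have "M * t j \<le> M * \<tau>" using j \<tau> M by simp
    also have "\<dots> \<le> \<Lambda> * \<tau>" using \<tau>0 c pos by (intro mult_right_mono) (auto simp: \<Lambda>_def)
    finally have "c * N (x b - x j) \<le> \<phi> b - \<phi> j" using cone[of j b] j ab N by auto
    moreover have "c * (\<Lambda> * \<tau>) \<le> c * N (x b - x j)" using N c by simp
    moreover have "(\<mu> + \<gamma>) * \<tau> \<le> c * (\<Lambda> * \<tau>)"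
    proof -
      have "\<mu> + \<gamma> \<le> c * \<Lambda>" using c M by (simp add: \<Lambda>_def field_simps)
      then show ?thesis using \<tau>0 by (simp add: mult.assoc[symmetric] mult_right_mono)
    qed
    moreover have "\<mu> * t b \<le> \<mu> * \<tau>" "0 \<le> \<mu> * t j" using \<tau> pos t[OF j(1)] by auto
    moreover have "\<phi> b - \<mu> * t b \<le> Y b" using ab by (intro Y_ge) auto
    ultimately show ?thesis using j(4) by (simp add: algebra_simps)
  qed
  \<comment> \<open>Starting at half height leaves room for an earlier block with
    \<open>t a \<le> \<kappa> * t b\<close>: there \<open>Y a \<le> Y b\<close> and
    \<open>\<gamma> * t a \<le> \<gamma> * t b / 2\<close>, so \<open>u a \<le> l b\<close>.\<close>
  define l u where "l a = Y a + \<gamma> * t a / 2" and "u a = Y a + \<gamma> * t a" for a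
  have overlap: "\<kappa> * t a < t b \<and> \<kappa> * t b < t a \<and> N (x b - x a) < \<Lambda> * max (t a) (t b)"
    if ab: "a \<in> S" "b \<in> S" "a < b" and y: "l a < y" "y < u a" "l b < y" "y < u b" for a b y
  proof (intro conjI; rule ccontr)
    have lb: "Y b \<le> l b" using t[OF ab(2)] pos by (simp add: l_def)
    have ta: "0 \<le> t a" "0 \<le> t b" using t ab by auto
    { assume "\<not> \<kappa> * t a < t b"
      then show False using small_after[OF ab] y lb by (simp add: u_def) }
    { assume *: "\<not> \<kappa> * t b < t a"
      have h: "\<kappa> * t b \<le> t b / 2" using mult_right_mono[OF \<kappa> ta(2)] by simp
      then have "Y a \<le> Y b" using * ta by (intro Y_mono) (use ab in auto)
      moreover have "\<gamma> * t a \<le> \<gamma> * (t b / 2)" using * h pos by (intro mult_left_mono) auto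
      ultimately show False using y by (simp add: l_def u_def) }
    { assume "\<not> N (x b - x a) < \<Lambda> * max (t a) (t b)"
      then have "Y a + \<gamma> * max (t a) (t b) \<le> Y b" using far_after[OF ab] by simp
      moreover have "\<gamma> * t a \<le> \<gamma> * max (t a) (t b)" using pos by simp
      ultimately show False using y lb by (simp add: u_def) }
  qed
  have mult: "card {a \<in> S. l a < y \<and> y < u a} \<le> P" (is "card ?I \<le> P") for y
  proof (cases "?I = {}")
    case False
    have finI: "finite ?I" using fin by simp
    \<comment> \<open>Relative to the largest size \<open>\<tau>\<close> over \<open>y\<close>, all
      sizes are at least \<open>\<kappa> * \<tau>\<close>. The points are therefore
      \<open>\<kappa> / 2 * \<tau>\<close> apart, and they are within
      \<open>\<Lambda> * \<tau>\<close> of each other, as packing requires.\<close>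
    define \<tau> where "\<tau> = Max (t ` ?I)"
    have "\<tau> \<in> t ` ?I" unfolding \<tau>_def using finI False by (intro Max_in) auto
    then obtain m where m: "m \<in> ?I" "\<tau> = t m" by blast
    have tle: "t a \<le> \<tau>" if "a \<in> ?I" for a
      unfolding \<tau>_def using finI that by (intro Max_ge) auto
    have "0 < \<gamma> * t m" using m(1) by (auto simp: l_def u_def)
    then have \<tau>0: "0 < \<tau>" using m(2) pos by (simp add: zero_less_mult_iff)
    have \<kappa>\<tau>: "\<kappa> * \<tau> \<le> t a" if a: "a \<in> ?I" for a
    proof -
      consider "a = m" | "a < m" | "m < a" by linarith
      then show ?thesis
      proof cases
        case 1
        then show ?thesis using \<kappa> \<tau>0 m(2) by (simp add: mult_left_le_one_le[of \<tau> \<kappa>] pos less_imp_le)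
      next
        case 2
        then show ?thesis using overlap[of a m y] a m by auto
      next
        case 3
        then show ?thesis using overlap[of m a y] a m by auto
      qed
    qed
    have sep: "\<kappa> / 2 * \<tau> \<le> N (x b - x a)" and close: "N (x b - x a) \<le> \<Lambda> * \<tau>"
      if ab: "a \<in> ?I" "b \<in> ?I" "a < b" for a b
    proof -
      have "t a \<le> 2 * N (x b - x a)" using later[of a a b] ab by auto
      then show "\<kappa> / 2 * \<tau> \<le> N (x b - x a)" using \<kappa>\<tau>[OF ab(1)] by simp
      have "N (x b - x a) < \<Lambda> * max (t a) (t b)" using overlap[of a b y] ab by auto
      also have "\<dots> \<le> \<Lambda> * \<tau>" using tle ab pos by (intro mult_left_mono) auto
      finally show "N (x b - x a) \<le> \<Lambda> * \<tau>" by simp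
    qed
    show ?thesis
    proof (rule pack[OF \<tau>0])
      fix a b assume ab: "a \<in> ?I" "b \<in> ?I"
      show "\<kappa> / 2 * \<tau> \<le> N (x a - x b)" if "a \<noteq> b"
        using sep[of a b] sep[of b a] ab that commute[of "x a" "x b"] by (metis linorder_neqE_nat)
      show "N (x a - x b) \<le> \<Lambda> * \<tau>"
        using close[of a b] close[of b a] ab commute[of "x a" "x b"] \<tau>0 pos
        by (cases a b rule: linorder_cases) auto
    qed
  next
    case True
    then show ?thesis by (simp only: card.empty)
  qed
  have range: "\<bar>\<phi> a - \<phi> o'\<bar> \<le> A * D" if "a \<in> S" for a
  proof -
    have "A * N (x a - x o') \<le> A * D" using bdd[OF o' that] pos by simp
    then show ?thesis using lip[OF o' that] by linarith
  qed
  have tD: "p * t a \<le> p * D" "0 \<le> p * t a" if "a \<in> S" "0 < p" for a p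
    using t[OF that(1)] that(2) by auto
  \<comment> \<open>All charged intervals lie in one window, since \<open>\<phi>\<close> differs
    from \<open>\<phi> o'\<close> by at most \<open>A * D\<close>; each has length
    \<open>\<gamma> * t a / 2\<close>.\<close>
  have "(\<Sum>a\<in>S. u a - l a) \<le> real P * (\<phi> o' + A * D + \<gamma> * D - (\<phi> o' - A * D - \<mu> * D))"
  proof (rule sum_interval_lengths_le[OF fin _ mult])
    fix a assume a: "a \<in> S"
    obtain j where j: "j \<in> S" "Y a = \<phi> j - \<mu> * t j" using Y_attained[OF a] by blast
    show "\<phi> o' - A * D - \<mu> * D \<le> l a \<and> l a \<le> u a \<and> u a \<le> \<phi> o' + A * D + \<gamma> * D"
      using range[OF j(1)] tD[OF j(1) pos(3)] tD[OF a pos(2)]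
      unfolding l_def u_def j(2) by (intro conjI; linarith)
  next
    have "0 \<le> A * D" "0 \<le> \<gamma> * D" "0 \<le> \<mu> * D" using D pos by auto
    then show "\<phi> o' - A * D - \<mu> * D \<le> \<phi> o' + A * D + \<gamma> * D" by linarith
  qed
  also have "(\<Sum>a\<in>S. u a - l a) = \<gamma> / 2 * sum t S"
    by (simp add: l_def u_def sum_distrib_left)
  finally show ?thesis using pos by (simp add: field_simps)
next
  case True
  have "0 < \<gamma>" "0 < \<mu>" using c M by (auto simp: \<gamma>_def \<mu>_def)
  moreover have "0 \<le> D" using scattered by (simp add: scattered_def)
  ultimately show ?thesis using True c by simp
qed

section \<open>Splitting a path by colours\<close>

lemma contractedD:
  assumes "contracted N xs" "i \<le> j" "j \<le> k" "k < length xs"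
  shows "N (xs ! k - xs ! j) \<le> N (xs ! k - xs ! i)"
proof (cases "i < j \<and> j < k")
  case True
  then show ?thesis using assms unfolding contracted_iff_nth by blast
next
  case False
  then consider "i = j" | "j = k" using assms by linarith
  then show ?thesis by cases auto
qed

text \<open>Both points are at distance at most \<open>N (xs ! j - xs ! i)\<close> from
  \<open>xs ! j\<close>.\<close>

lemma contracted_le_twice:
  assumes "contracted N xs" "i \<le> k" "k \<le> j" "i \<le> l" "l \<le> j" "j < length xs"
  shows "N (xs ! k - xs ! l) \<le> 2 * N (xs ! j - xs ! i)"
  using contractedD[OF assms(1,2,3,6)] contractedD[OF assms(1,4,5,6)]
    triangle_diff[of "xs ! k" "xs ! l" "xs ! j"] commute[of "xs ! k" "xs ! j"] by linarith

lemma path_len_nonneg: "0 \<le> path_len N xs"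
  by (simp add: path_len_nth sum_nonneg)

text \<open>
  A step from \<open>x\<close> costs at most twice the distance from \<open>x\<close> to the next point of its own
  colour, if there is one.
\<close>

lemma path_len_le_colour_classes:
  assumes "contracted N xs" "\<And>x y. x \<in> set xs \<Longrightarrow> y \<in> set xs \<Longrightarrow> N (x - y) \<le> R"
    and "c ` set xs \<subseteq> {..<K :: nat}"
  shows "path_len N xs \<le> 2 * (\<Sum>k<K. path_len N (filter (\<lambda>x. c x = k) xs)) + R * card (c ` set xs)"
  using assms
proof (induction xs)
  case (Cons x xs)
  let ?S = "\<lambda>xs. \<Sum>k<K. path_len N (filter (\<lambda>x. c x = k) xs)"
  let ?F = "filter (\<lambda>y. c y = c x) xs"
  have IH: "path_len N xs \<le> 2 * ?S xs + R * card (c ` set xs)"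
    using Cons by simp
  have R: "0 \<le> R" using Cons.prems(2)[of x x] by simp
  have cx: "c x < K" using Cons.prems(3) by simp
  have len: "path_len N (x # ys) = (if ys = [] then 0 else N (hd ys - x)) + path_len N ys" for ys
    by (cases ys) auto
  \<comment> \<open>The class of \<open>x\<close> gains the jump from \<open>x\<close> to the next
    point of its colour, or nothing if there is none.\<close>
  define v where "v = (if ?F = [] then 0 else N (hd ?F - x))"
  have S: "?S (x # xs) = ?S xs + v"
  proof -
    have "?S (x # xs) = (\<Sum>k<K. path_len N (filter (\<lambda>x. c x = k) xs) + (if k = c x then v else 0))"
      by (intro sum.cong) (auto simp: len v_def)
    then show ?thesis using cx by (simp add: sum.distrib)
  qed
  show ?case
  proof (cases "xs = []")
    case False
    show ?thesis
    proof (cases "?F = []")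
      case True
      \<comment> \<open>The last point of a colour has no such jump; its step is paid for by
        \<open>R\<close>, once per colour.\<close>
      then have "c x \<notin> c ` set xs" by (auto simp: filter_empty_conv)
      then have "card (c ` set (x # xs)) = Suc (card (c ` set xs))" by simp
      moreover have "N (hd xs - x) \<le> R" using Cons.prems(2)[of "hd xs" x] False by simp
      moreover have "path_len N (x # xs) = N (hd xs - x) + path_len N xs"
        using False by (simp add: len)
      moreover have "?S (x # xs) = ?S xs" using S True by (simp add: v_def)
      ultimately show ?thesis using IH by (simp add: algebra_simps del: path_len.simps)
    next
      case ne: False
      then have "hd ?F \<in> set xs" using hd_in_set[OF ne] by auto
      then obtain j where j: "j < length xs" "hd ?F = xs ! j" by (auto simp: in_set_conv_nth)
      then have "N ((x # xs) ! 1 - (x # xs) ! 0) \<le> 2 * N ((x # xs) ! Suc j - (x # xs) ! 0)"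
        using Cons.prems(1) by (intro contracted_le_twice) auto
      then have "N (hd xs - x) \<le> 2 * N (hd ?F - x)" using j False by (simp add: hd_conv_nth)
      moreover have "path_len N (x # xs) = N (hd xs - x) + path_len N xs"
        using False by (simp add: len)
      moreover have "?S (x # xs) = ?S xs + N (hd ?F - x)" using S ne by (simp add: v_def)
      moreover have "R * card (c ` set xs) \<le> R * card (c ` set (x # xs))"
        using R by (intro mult_left_mono of_nat_mono card_mono) auto
      ultimately show ?thesis using IH by linarith
    qed
  next
    case True
    then show ?thesis using R by (simp add: sum_nonneg path_len_nonneg)
  qed
qed simp

section \<open>Compatible directions and a functional growing along them\<close>

text \<open>With \<open>w = x - y\<close> and \<open>h = z - y\<close> the inequality says that
  \<open>z\<close> is at least as close to \<open>x\<close> as \<open>y\<close> is, which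
  self-contractedness gives for \<open>y\<close>, \<open>z\<close>, \<open>x\<close> in this
  order.\<close>

definition compatible :: "('a \<Rightarrow> nat) \<Rightarrow> nat \<Rightarrow> nat \<Rightarrow> bool" where
  "compatible c e e' \<longleftrightarrow> (\<exists>w h. w \<noteq> 0 \<and> h \<noteq> 0 \<and> c w = e \<and> c h = e' \<and> N (w - h) \<le> N w)"

text \<open>
  If \<open>N (w - h) \<le> N w\<close>, the functional norming \<open>w\<close> is nonnegative at \<open>h\<close>. Hence
  the functional norming one vector of a compatible family is almost nonnegative on the family. Summing over
  representatives of a coarse colouring keeps the number \<open>K0\<close> of these errors independent of the
  fineness \<open>\<eta>\<close>, so \<open>\<eta>\<close> can be chosen to beat it.
\<close>

lemma cone_functional:
  obtains c :: "'a \<Rightarrow> nat" and K A where "0 \<le> A" "\<And>w. c w < K"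
    "\<And>S. \<lbrakk>\<And>e e'. e \<in> S \<Longrightarrow> e' \<in> S \<Longrightarrow> compatible c e e'\<rbrakk> \<Longrightarrow>
      \<exists>f. (\<forall>y. \<bar>f \<bullet> y\<bar> \<le> A * N y) \<and> (\<forall>h. h \<noteq> 0 \<longrightarrow> c h \<in> S \<longrightarrow> N h \<le> 4 * (f \<bullet> h))"
proof -
  obtain b where b: "0 < b" "\<And>x. norm x \<le> b * N x" by (fact lower_bound)
  obtain B where B: "0 < B" "\<And>x. N x \<le> B * norm x" by (fact upper_bound)
  define a where "a w = (SOME a. a \<bullet> w = N w \<and> (\<forall>y. a \<bullet> y \<le> N y))" for w
  have "a w \<bullet> w = N w \<and> (\<forall>y. a w \<bullet> y \<le> N y)" for w
    unfolding a_def by (rule someI_ex) (use norming_functional[of w] in blast)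
  then have a: "a w \<bullet> w = N w" "a w \<bullet> y \<le> N y" for w y by auto
  have norm_a: "norm (a w) \<le> B" for w
  proof (cases "a w = 0")
    case False
    have "norm (a w) * norm (a w) \<le> B * norm (a w)"
      using a(2)[of w "a w"] B(2)[of "a w"] by (simp add: power2_norm_eq_inner[symmetric] power2_eq_square)
    then show ?thesis using False by simp
  qed (use B in simp)
  define U where "U w = (1 / N w) *\<^sub>R w" for w
  have U: "N (U w) = 1" "norm (U w) \<le> b" "w = N w *\<^sub>R U w" if "w \<noteq> 0" for w
  proof -
    show "N (U w) = 1" "w = N w *\<^sub>R U w" using that by (auto simp: U_def scale)
    then show "norm (U w) \<le> b" using b(2)[of "U w"] by simp
  qed
  \<comment> \<open>The coarse classes have \<open>N\<close>-diameter at most \<open>1 / 2\<close>,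
    so the functional norming one unit vector is at least \<open>1 / 2\<close> on the unit vectors
    of its class.\<close>
  obtain c0 :: "'a \<Rightarrow> nat" and K0 where c0: "\<And>z. z \<in> cball 0 b \<Longrightarrow> c0 z < K0"
    "\<And>z z'. z \<in> cball 0 b \<Longrightarrow> z' \<in> cball 0 b \<Longrightarrow> c0 z = c0 z' \<Longrightarrow> dist z z' < 1 / (2 * B)"
    using bounded_finite_colouring[OF bounded_cball, of "1 / (2 * B)"] B(1)
    by (metis divide_pos_pos mult_pos_pos zero_less_numeral zero_less_one)
  \<comment> \<open>Up to \<open>K0\<close> errors \<open>(B + b) * \<eta>\<close> then sum to at
    most \<open>1 / 4\<close>, half of the main term \<open>1 / 2\<close>; what remains gives the
    factor 4.\<close>
  define \<eta> where "\<eta> = 1 / (4 * (real K0 + 1) * (B + b))"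
  have \<eta>: "0 < \<eta>" using b B by (simp add: \<eta>_def)
  obtain c1 :: "'a \<times> 'a \<Rightarrow> nat" and K where c1: "\<And>z. z \<in> cball 0 b \<times> cball 0 B \<Longrightarrow> c1 z < K"
    "\<And>z z'. z \<in> cball 0 b \<times> cball 0 B \<Longrightarrow> z' \<in> cball 0 b \<times> cball 0 B \<Longrightarrow> c1 z = c1 z' \<Longrightarrow> dist z z' < \<eta>"
    using bounded_finite_colouring[OF bounded_Times[OF bounded_cball bounded_cball] \<eta>] by blast
  \<comment> \<open>The colour records the norming functional next to the direction, since the
    chosen \<open>a w\<close> need not vary continuously. Division by zero makes
    \<open>U 0 = 0\<close>, so the zero vector is coloured too.\<close>
  define c where "c w = c1 (U w, a w)" for w
  have U0: "U 0 = 0" by (simp add: U_def)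
  have Ub: "norm (U w) \<le> b" for w using U(2)[of w] U0 b by (cases "w = 0") auto
  have mem: "(U w, a w) \<in> cball 0 b \<times> cball 0 B" for w using Ub norm_a by auto
  have close: "norm (U w - U w') \<le> \<eta>" "norm (a w - a w') \<le> \<eta>" if "c w = c w'" for w w'
  proof -
    have "dist (U w, a w) (U w', a w') < \<eta>" using c1(2)[OF mem mem] that by (simp add: c_def)
    then show "norm (U w - U w') \<le> \<eta>" "norm (a w - a w') \<le> \<eta>"
      using dist_fst_le[of "(U w, a w)" "(U w', a w')"] dist_snd_le[of "(U w, a w)" "(U w', a w')"]
      by (auto simp: dist_norm)
  qed
  show thesis
  proof (rule that[of "real K0" c K])
    show "c w < K" for w using c1(1)[OF mem] by (simp add: c_def)
    fix S
    assume S: "\<And>e e'. e \<in> S \<Longrightarrow> e' \<in> S \<Longrightarrow> compatible c e e'"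
    \<comment> \<open>Replacing the compatible witnesses \<open>w'\<close>, \<open>h'\<close> by
      \<open>w\<close>, \<open>h\<close> of the same colours changes the functional, at a cost of
      \<open>\<eta> * b\<close>, and the direction, at a cost of \<open>B * \<eta>\<close>.\<close>
    have almost: "- ((B + b) * \<eta>) \<le> a w \<bullet> U h" if cS: "c w \<in> S" "c h \<in> S" for w h
    proof -
      obtain w' h' where wh: "w' \<noteq> 0" "h' \<noteq> 0" "c w' = c w" "c h' = c h" "N (w' - h') \<le> N w'"
        using S[OF cS] unfolding compatible_def by blast
      have "0 \<le> a w' \<bullet> h'"
        using a(1)[of w'] a(2)[of w' "w' - h'"] wh(5) by (simp add: inner_diff_right)
      then have "0 \<le> a w' \<bullet> U h'" by (simp add: U_def)
      moreover have "\<bar>(a w' - a w) \<bullet> U h'\<bar> \<le> \<eta> * b"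
        using Cauchy_Schwarz_ineq2[of "a w' - a w" "U h'"]
          mult_mono[OF close(2)[OF wh(3)] Ub[of h']] \<eta> by simp
      moreover have "\<bar>a w \<bullet> (U h' - U h)\<bar> \<le> B * \<eta>"
        using Cauchy_Schwarz_ineq2[of "a w" "U h' - U h"]
          mult_mono[OF norm_a[of w] close(1)[OF wh(4)]] B by simp
      moreover have "a w' \<bullet> U h' = (a w' - a w) \<bullet> U h' + a w \<bullet> (U h' - U h) + a w \<bullet> U h"
        by (simp add: inner_diff_left inner_diff_right)
      moreover have "(B + b) * \<eta> = B * \<eta> + \<eta> * b" by (simp add: algebra_simps)
      ultimately show ?thesis by linarith
    qed
    define T where "T = {w. w \<noteq> 0 \<and> c w \<in> S}"
    define rep where "rep k = (SOME w. w \<in> T \<and> c0 (U w) = k)" for k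
    define F where "F = (\<lambda>w. c0 (U w)) ` T"
    have rep: "rep k \<in> T" "c0 (U (rep k)) = k" if "k \<in> F" for k
      using someI_ex[of "\<lambda>w. w \<in> T \<and> c0 (U w) = k"] that by (auto simp: rep_def F_def)
    have F: "F \<subseteq> {..<K0}" using c0(1) Ub by (auto simp: F_def)
    then have finF: "finite F" and cardF: "card F \<le> K0"
      using finite_subset card_mono[of "{..<K0}" F] by auto
    define f where "f = (\<Sum>k\<in>F. a (rep k))"
    have f_le: "f \<bullet> y \<le> K0 * N y" for y
    proof -
      have "f \<bullet> y \<le> (\<Sum>k\<in>F. N y)"
        unfolding f_def inner_sum_left by (intro sum_mono a(2))
      also have "\<dots> \<le> K0 * N y" using cardF by (simp add: mult_right_mono)
      finally show ?thesis .
    qed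
    have "N h \<le> 4 * (f \<bullet> h)" if h: "h \<in> T" for h
    proof -
      let ?k = "c0 (U h)"
      have k: "?k \<in> F" using h by (simp add: F_def)
      let ?r = "rep ?k"
      have r0: "?r \<noteq> 0" using rep(1)[OF k] by (simp add: T_def)
      have "dist (U h) (U ?r) < 1 / (2 * B)" using c0(2) Ub rep(2)[OF k] by auto
      then have "N (U ?r - U h) \<le> 1 / 2"
        using B(2)[of "U ?r - U h"] B(1) by (simp add: dist_norm norm_minus_commute field_simps)
      then have "a ?r \<bullet> (U ?r - U h) \<le> 1 / 2" using a(2)[of ?r "U ?r - U h"] by linarith
      moreover have "a ?r \<bullet> U ?r = 1" using a(1)[of ?r] r0 by (simp add: U_def)
      ultimately have main: "1 / 2 \<le> a ?r \<bullet> U h" by (simp add: inner_diff_right)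
      have "(\<Sum>k\<in>F - {?k}. - ((B + b) * \<eta>)) \<le> (\<Sum>k\<in>F - {?k}. a (rep k) \<bullet> U h)"
        using rep h by (intro sum_mono almost) (auto simp: T_def)
      moreover have "card (F - {?k}) * ((B + b) * \<eta>) \<le> 1 / 4"
      proof -
        have "card (F - {?k}) \<le> K0" using cardF card_Diff1_le[of F ?k] by linarith
        then have "card (F - {?k}) * ((B + b) * \<eta>) \<le> (real K0 + 1) * ((B + b) * \<eta>)"
          using B b \<eta> by (intro mult_right_mono) auto
        also have "\<dots> = 1 / 4"
        proof -
          define p where "p = (real K0 + 1) * (B + b)"
          have "p \<noteq> 0" using B b by (simp add: p_def)
          moreover have "\<eta> = 1 / (4 * p)" by (simp add: \<eta>_def p_def mult.assoc)
          ultimately have "p * \<eta> = 1 / 4" by simp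
          then show ?thesis by (simp add: p_def mult.assoc)
        qed
        finally show ?thesis .
      qed
      moreover have "f \<bullet> U h = a ?r \<bullet> U h + (\<Sum>k\<in>F - {?k}. a (rep k) \<bullet> U h)"
        unfolding f_def inner_sum_left using finF k by (rule sum.remove)
      ultimately have "1 \<le> 4 * (f \<bullet> U h)" using main by simp
      then have "N h * 1 \<le> N h * (4 * (f \<bullet> U h))" by (intro mult_left_mono) auto
      also have "N h * (4 * (f \<bullet> U h)) = 4 * (f \<bullet> h)"
        using h by (simp add: U_def T_def)
      finally show ?thesis by simp
    qed
    moreover have "\<bar>f \<bullet> y\<bar> \<le> real K0 * N y" for y
      using f_le[of y] f_le[of "- y"] by simp
    ultimately show "\<exists>f. (\<forall>y. \<bar>f \<bullet> y\<bar> \<le> real K0 * N y) \<and> (\<forall>h. h \<noteq> 0 \<longrightarrow> c h \<in> S \<longrightarrow> N h \<le> 4 * (f \<bullet> h))"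
      by (intro exI[of _ f]) (auto simp: T_def)
  qed simp
qed

section \<open>Uniform constants and the induction on colours\<close>

text \<open>The packing number is fixed before the points and their sizes, so \<open>C\<close>
  depends on \<open>c\<close>, \<open>A\<close>, \<open>M\<close> and the norm alone.\<close>

lemma sum_scales_bound:
  fixes A M c :: real
  assumes c: "0 < c" "c \<le> A" and M: "1 \<le> M"
  obtains C where "0 \<le> C"
    "\<And>S x t \<phi> D. scattered c A M D S x t \<phi> \<Longrightarrow> sum t S \<le> C * D"
proof -
  let ?\<mu> = "2 * A * M" and ?\<gamma> = "c / 4"
  have pos: "0 < ?\<mu>" "0 < ?\<gamma>" using c M by auto
  then have "0 < ?\<gamma> / ?\<mu> / 2" by simp
  then obtain P :: nat where P: "\<And>\<tau> (I :: nat set) x. \<lbrakk>0 < \<tau>;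
      \<And>a b. a \<in> I \<Longrightarrow> b \<in> I \<Longrightarrow> a \<noteq> b \<Longrightarrow> ?\<gamma> / ?\<mu> / 2 * \<tau> \<le> N (x a - x b);
      \<And>a b. a \<in> I \<Longrightarrow> b \<in> I \<Longrightarrow> N (x a - x b) \<le> (M + (?\<mu> + ?\<gamma>) / c) * \<tau>\<rbrakk> \<Longrightarrow> card I \<le> P"
    using packing by blast
  show thesis
  proof (rule that[of "2 * real P * (2 * A + ?\<mu> + ?\<gamma>) / ?\<gamma>"])
    show "0 \<le> 2 * real P * (2 * A + ?\<mu> + ?\<gamma>) / ?\<gamma>" using pos c by simp
  qed (rule sum_scales_le[OF c M _ P])
qed

text \<open>
  Splitting the block by the colour of the vector to \<open>x\<^sub>k\<close> leaves one class that is still long, so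
  its differences show all colours of \<open>V\<close>, all seen from \<open>x\<^sub>k\<close> in the same colour
  \<open>q\<close>.
\<close>

lemma later_points_in_cone:
  fixes c :: "'a \<Rightarrow> nat" and C A :: real
  assumes xs: "contracted N xs" "sorted_wrt (\<lambda>x y. y \<noteq> x \<longrightarrow> c (y - x) \<in> V) xs"
    and c: "\<And>w. c w < K" and C: "0 \<le> C" and A: "0 \<le> A"
    and low: "\<And>ys e. \<lbrakk>e \<in> V; ys \<noteq> []; contracted N ys;
      sorted_wrt (\<lambda>x y. y \<noteq> x \<longrightarrow> c (y - x) \<in> V - {e}) ys\<rbrakk> \<Longrightarrow> path_len N ys \<le> C * N (last ys - hd ys)"
    and f: "\<And>y. \<bar>f \<bullet> y\<bar> \<le> A * N y"
      "\<And>h. \<lbrakk>h \<noteq> 0; c h \<in> V; \<forall>e'\<in>V. compatible c (c h) e'\<rbrakk> \<Longrightarrow> N h \<le> 4 * (f \<bullet> h)"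
    and ijk: "i \<le> j" "j \<le> k" "k < length xs"
    and high: "(4 * real K * C + 2 * real K + 3) * N (xs ! j - xs ! i) < (\<Sum>l = i..<j. N (xs ! Suc l - xs ! l))"
    and far: "(4 + 16 * A) * N (xs ! j - xs ! i) \<le> N (xs ! k - xs ! i)"
  shows "N (xs ! k - xs ! i) \<le> 8 * (f \<bullet> (xs ! k - xs ! i))"
proof -
  define R where "R = N (xs ! j - xs ! i)"
  have R2: "N (xs ! l - xs ! l') \<le> 2 * R" if "i \<le> l" "l \<le> j" "i \<le> l'" "l' \<le> j" for l l'
    unfolding R_def using that ijk by (intro contracted_le_twice[OF xs(1)]) auto
  have R: "0 < R"
  proof (rule ccontr)
    assume "\<not> 0 < R"
    then have "R = 0" using nonneg[of "xs ! j - xs ! i"] by (simp add: R_def del: nonneg)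
    then have "N (xs ! Suc l - xs ! l) \<le> 0" if "l \<in> {i..<j}" for l using R2[of "Suc l" l] that by simp
    then have "(\<Sum>l = i..<j. N (xs ! Suc l - xs ! l)) \<le> 0" by (intro sum_nonpos) auto
    then show False using high \<open>R = 0\<close> by (simp add: R_def)
  qed
  define ys where "ys = take (Suc j - i) (drop i xs)"
  have len_ys: "length ys = Suc (j - i)" and nth_ys: "ys ! l = xs ! (i + l)" if "l \<le> j - i" for l
    using ijk that by (auto simp: ys_def)
  have ys: "\<exists>l. i \<le> l \<and> l \<le> j \<and> y = xs ! l" if "y \<in> set ys" for y
  proof -
    obtain l where "l < length ys" "y = ys ! l" using \<open>y \<in> set ys\<close> by (auto simp: in_set_conv_nth)
    then show ?thesis using len_ys[of 0] nth_ys[of l] ijk by (intro exI[of _ "i + l"]) auto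
  qed
  have contr: "contracted N ys"
    unfolding contracted_iff_nth
  proof (intro allI impI)
    fix p q r assume "p < q" "q < r" "r < length ys"
    then show "N (ys ! r - ys ! q) \<le> N (ys ! r - ys ! p)"
      using contractedD[OF xs(1), of "i + p" "i + q" "i + r"] nth_ys[of p] nth_ys[of q] nth_ys[of r]
        len_ys[of 0] ijk by simp
  qed
  have dir: "sorted_wrt (\<lambda>x y. y \<noteq> x \<longrightarrow> c (y - x) \<in> V) ys"
    unfolding ys_def using xs(2) by (intro sorted_wrt_take sorted_wrt_drop)
  have to_k: "sorted_wrt (\<lambda>y z. N (xs ! k - z) \<le> N (xs ! k - y)) ys"
    unfolding sorted_wrt_iff_nth_less
  proof (intro allI impI)
    fix p q assume "p < q" "q < length ys"
    then show "N (xs ! k - ys ! q) \<le> N (xs ! k - ys ! p)"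
      using contractedD[OF xs(1), of "i + p" "i + q" k] nth_ys[of p] nth_ys[of q] len_ys[of 0] ijk by simp
  qed
  define d where "d y = c (xs ! k - y)" for y
  define zs where "zs q = filter (\<lambda>y. d y = q) ys" for q
  have close: "N (y - xs ! i) \<le> 2 * R" "N (y - z) \<le> 2 * R" if yz: "y \<in> set ys" "z \<in> set ys" for y z
  proof -
    obtain l l' where "i \<le> l" "l \<le> j" "y = xs ! l" "i \<le> l'" "l' \<le> j" "z = xs ! l'"
      using ys[OF yz(1)] ys[OF yz(2)] by blast
    then show "N (y - xs ! i) \<le> 2 * R" "N (y - z) \<le> 2 * R" using R2[of l i] R2[of l l'] ijk by auto
  qed
  have "(\<Sum>l = i..<j. N (xs ! Suc l - xs ! l)) = (\<Sum>l<j - i. N (xs ! Suc (i + l) - xs ! (i + l)))"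
    unfolding sum.atLeastLessThan_shift_0[of _ i j] by (simp add: atLeast0LessThan)
  also have "\<dots> = path_len N ys"
    unfolding path_len_nth using len_ys[of 0] nth_ys by (intro sum.cong) auto
  finally have sum_eq: "(\<Sum>l = i..<j. N (xs ! Suc l - xs ! l)) = path_len N ys" .
  \<comment> \<open>Pigeonhole: if every class had length at most \<open>C * (2 * R)\<close>, the
    colour splitting would bound the block by \<open>(4 * real K * C + 2 * real K) * R\<close>,
    below the threshold in \<open>high\<close>.\<close>
  have "\<exists>q<K. C * (2 * R) < path_len N (zs q)"
  proof (rule ccontr)
    assume *: "\<not> ?thesis"
    have "path_len N ys \<le> 2 * (\<Sum>q<K. path_len N (zs q)) + 2 * R * card (d ` set ys)"
      unfolding zs_def
      using contr close(2) c by (intro path_len_le_colour_classes) (auto simp: d_def)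
    also have "(\<Sum>q<K. path_len N (zs q)) \<le> (\<Sum>q<K. C * (2 * R))"
      using * by (intro sum_mono) (meson lessThan_iff not_less)
    also have "2 * R * card (d ` set ys) \<le> 2 * R * K"
    proof -
      have "card (d ` set ys) \<le> card {..<K}" using c by (intro card_mono) (auto simp: d_def)
      then show ?thesis using R by simp
    qed
    finally have "path_len N ys \<le> (4 * real K * C + 2 * real K) * R" by (simp add: algebra_simps)
    also have "\<dots> \<le> (4 * real K * C + 2 * real K + 3) * R" using R by (intro mult_right_mono) auto
    finally show False using high sum_eq by (simp add: R_def)
  qed
  then obtain q where q: "C * (2 * R) < path_len N (zs q)" by blast
  have "0 \<le> C * (2 * R)" using C R by simp
  then have ne: "zs q \<noteq> []" using q by auto
  have zs_ys: "set (zs q) \<subseteq> set ys" by (auto simp: zs_def)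
  have "N (last (zs q) - hd (zs q)) \<le> 2 * R" using ne zs_ys by (intro close(2)) auto
  then have "C * N (last (zs q) - hd (zs q)) \<le> C * (2 * R)" using C by (rule mult_left_mono)
  then have zs_long: "C * N (last (zs q) - hd (zs q)) < path_len N (zs q)" using q by linarith
  have dirz: "sorted_wrt (\<lambda>x y. y \<noteq> x \<longrightarrow> c (y - x) \<in> V) (zs q)"
    and zs_to_k: "sorted_wrt (\<lambda>y z. N (xs ! k - z) \<le> N (xs ! k - y)) (zs q)"
    and contrz: "contracted N (zs q)"
    unfolding zs_def using dir to_k contr by (auto intro: sorted_wrt_filter contracted_filter)
  have far_y: "4 * R \<le> N (xs ! k - y) + 2 * R" if "y \<in> set ys" for y
  proof -
    have "0 \<le> A * R" using A R by simp
    then have "4 * R \<le> N (xs ! k - xs ! i)" using far by (simp add: R_def algebra_simps)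
    also have "\<dots> \<le> N (xs ! k - y) + N (y - xs ! i)" by (rule triangle_diff)
    finally show ?thesis using close(1)[OF that that] by linarith
  qed
  then have nz: "xs ! k - y \<noteq> 0" if "y \<in> set ys" for y using that R by fastforce
  obtain y where y: "y \<in> set (zs q)" using ne by (cases "zs q") auto
  then have yys: "y \<in> set ys" and dy: "c (xs ! k - y) = q" by (auto simp: zs_def d_def)
  have "q \<in> V"
  proof -
    obtain l where l: "i \<le> l" "l \<le> j" "y = xs ! l" using ys[OF yys] by blast
    then have "l \<noteq> k" using nz[OF yys] by auto
    then have "xs ! k \<noteq> xs ! l \<longrightarrow> c (xs ! k - xs ! l) \<in> V"
      using sorted_wrt_nth_less[OF xs(2), of l k] l ijk by simp
    then show ?thesis using nz[OF yys] dy l(3) by auto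
  qed
  moreover have "compatible c q e" if e: "e \<in> V" for e
  proof -
    \<comment> \<open>The class is too long for \<open>low\<close>, so its differences cannot all
      avoid \<open>e\<close>. The vector \<open>?w\<close> has colour \<open>q\<close>, like all
      vectors from the class to \<open>xs ! k\<close>.\<close>
    have "\<not> sorted_wrt (\<lambda>x y. y \<noteq> x \<longrightarrow> c (y - x) \<in> V - {e}) (zs q)"
      using low[OF e ne contrz] zs_long by linarith
    then obtain l l' where l: "l < l'" "l' < length (zs q)" "zs q ! l' \<noteq> zs q ! l"
        "c (zs q ! l' - zs q ! l) \<notin> V - {e}"
      unfolding sorted_wrt_iff_nth_less by blast
    let ?w = "xs ! k - zs q ! l" and ?h = "zs q ! l' - zs q ! l"
    have "c ?h = e" using sorted_wrt_nth_less[OF dirz l(1,2)] l(3,4) by blast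
    moreover have mem: "zs q ! l \<in> set (zs q)" using l by simp
    then have "?w \<noteq> 0" "c ?w = q" using nz zs_ys by (auto simp: zs_def d_def)
    moreover have "N (?w - ?h) \<le> N ?w" using sorted_wrt_nth_less[OF zs_to_k l(1,2)] by simp
    ultimately show ?thesis unfolding compatible_def using l(3) by (intro exI[of _ ?w] exI[of _ ?h]) auto
  qed
  ultimately have main: "N (xs ! k - y) \<le> 4 * (f \<bullet> (xs ! k - y))"
    using f(2)[OF nz[OF yys]] dy by blast
  \<comment> \<open>Moving the base point from \<open>y\<close> back to \<open>xs ! i\<close> costs
    at most \<open>2 * R\<close> in distance and \<open>2 * (A * R)\<close> in \<open>f\<close>. The
    factor \<open>4 + 16 * A\<close> in \<open>far\<close> covers both once the slope is lowered
    from \<open>1 / 4\<close> to \<open>1 / 8\<close>.\<close>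
  have "A * N (y - xs ! i) \<le> A * (2 * R)" using close(1)[OF yys yys] A by (rule mult_left_mono)
  then have "\<bar>f \<bullet> (y - xs ! i)\<bar> \<le> 2 * (A * R)" using f(1)[of "y - xs ! i"] by linarith
  moreover have "f \<bullet> (xs ! k - xs ! i) = f \<bullet> (xs ! k - y) + f \<bullet> (y - xs ! i)"
    by (simp add: inner_diff_right)
  moreover have "N (xs ! k - xs ! i) \<le> N (xs ! k - y) + 2 * R"
    using triangle_diff[of "xs ! k" "xs ! i" y] close(1)[OF yys yys] by linarith
  moreover have "4 * R + 16 * (A * R) \<le> N (xs ! k - xs ! i)"
    using far by (simp add: R_def algebra_simps)
  ultimately show ?thesis using main by linarith
qed

text \<open>Jump from \<open>i\<close> to \<open>e i\<close> and repeat until \<open>m\<close> is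
  reached; \<open>S\<close> collects the starting points visited.\<close>

lemma greedy_blocks:
  fixes d :: "nat \<Rightarrow> nat \<Rightarrow> real" and s :: "nat \<Rightarrow> real"
  assumes e: "\<And>i. i < m \<Longrightarrow> i < e i \<and> e i \<le> m \<and> sum s {i..<e i} \<le> C * t i" and "i \<le> m"
  shows "\<exists>S\<subseteq>{i..<m}. sum s {i..<m} \<le> C * sum t S \<and> (\<forall>a\<in>S. \<forall>b\<in>S. a < b \<longrightarrow> e a \<le> b)"
  using \<open>i \<le> m\<close>
proof (induction "m - i" arbitrary: i rule: less_induct)
  case less
  show ?case
  proof (cases "i = m")
    case False
    then have i: "i < m" "i < e i" "e i \<le> m" "sum s {i..<e i} \<le> C * t i" using less.prems e[of i] by auto
    have "m - e i < m - i" using i by linarith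
    from less.hyps[OF this i(3)] obtain S where S: "S \<subseteq> {e i..<m}" "sum s {e i..<m} \<le> C * sum t S"
        "\<forall>a\<in>S. \<forall>b\<in>S. a < b \<longrightarrow> e a \<le> b"
      by blast
    have "finite S" "i \<notin> S" using S(1) i finite_subset by auto
    moreover have "sum s {i..<m} = sum s {i..<e i} + sum s {e i..<m}"
      using i by (simp add: sum.atLeastLessThan_concat)
    ultimately have "sum s {i..<m} \<le> C * sum t (insert i S)" using i S(2) by (simp add: algebra_simps)
    then show ?thesis using S i by (intro exI[of _ "insert i S"]) force
  qed (auto intro: exI[of _ "{}"])
qed

text \<open>The induction hypothesis, for \<open>V\<close> minus one colour, supplies
  \<open>low\<close>. Maximal blocks with length at most \<open>C2\<close> times the distance of
  their endpoints are extended by one step to meet \<open>high\<close>; their starting points then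
  form a scattered family, which bounds the sum of the block sizes. \<open>C\<close> is chosen
  before the list, as the next stage of the induction needs.\<close>

lemma path_len_le_of_colours:
  fixes c :: "'a \<Rightarrow> nat" and A :: real
  assumes A: "0 \<le> A" and c: "\<And>w. c w < K"
    and cone: "\<And>S. \<lbrakk>\<And>e e'. e \<in> S \<Longrightarrow> e' \<in> S \<Longrightarrow> compatible c e e'\<rbrakk> \<Longrightarrow>
      \<exists>f. (\<forall>y. \<bar>f \<bullet> y\<bar> \<le> A * N y) \<and> (\<forall>h. h \<noteq> 0 \<longrightarrow> c h \<in> S \<longrightarrow> N h \<le> 4 * (f \<bullet> h))"
    and "finite V"
  shows "\<exists>C\<ge>0. \<forall>xs. xs \<noteq> [] \<longrightarrow> contracted N xs \<longrightarrow>
    sorted_wrt (\<lambda>x y. y \<noteq> x \<longrightarrow> c (y - x) \<in> V) xs \<longrightarrow> path_len N xs \<le> C * N (last xs - hd xs)"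
  using \<open>finite V\<close>
proof (induction V rule: finite_psubset_induct)
  case (psubset V)
  have "\<forall>e\<in>V. \<exists>C\<ge>0. \<forall>xs. xs \<noteq> [] \<longrightarrow> contracted N xs \<longrightarrow>
      sorted_wrt (\<lambda>x y. y \<noteq> x \<longrightarrow> c (y - x) \<in> V - {e}) xs \<longrightarrow> path_len N xs \<le> C * N (last xs - hd xs)"
  proof
    fix e assume "e \<in> V"
    then have "V - {e} \<subset> V" by blast
    then show "\<exists>C\<ge>0. \<forall>xs. xs \<noteq> [] \<longrightarrow> contracted N xs \<longrightarrow>
        sorted_wrt (\<lambda>x y. y \<noteq> x \<longrightarrow> c (y - x) \<in> V - {e}) xs \<longrightarrow> path_len N xs \<le> C * N (last xs - hd xs)"
      by (rule psubset.IH)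
  qed
  then obtain C0 where C0: "\<forall>e\<in>V. 0 \<le> C0 e \<and> (\<forall>xs. xs \<noteq> [] \<longrightarrow> contracted N xs \<longrightarrow>
      sorted_wrt (\<lambda>x y. y \<noteq> x \<longrightarrow> c (y - x) \<in> V - {e}) xs \<longrightarrow> path_len N xs \<le> C0 e * N (last xs - hd xs))"
    unfolding bchoice_iff by blast
  define C1 where "C1 = sum C0 V"
  have C1: "C0 e \<le> C1" if "e \<in> V" for e
    unfolding C1_def using C0 psubset.hyps that by (auto intro!: member_le_sum)
  have C1_nonneg: "0 \<le> C1" unfolding C1_def using C0 by (intro sum_nonneg) auto
  have low: "path_len N ys \<le> C1 * N (last ys - hd ys)" if "e \<in> V" "ys \<noteq> []" "contracted N ys"
      "sorted_wrt (\<lambda>x y. y \<noteq> x \<longrightarrow> c (y - x) \<in> V - {e}) ys" for ys e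
  proof -
    have "path_len N ys \<le> C0 e * N (last ys - hd ys)" using C0 that by blast
    also have "\<dots> \<le> C1 * N (last ys - hd ys)" using C1[OF that(1)] by (simp add: mult_right_mono)
    finally show ?thesis .
  qed
  \<comment> \<open>Any two colours of \<open>V'\<close> are compatible, as each is compatible with
    all of \<open>V\<close>, so \<open>cone\<close> applies. Directions from long blocks to far
    points get colours in \<open>V'\<close>.\<close>
  define V' where "V' = {e \<in> V. \<forall>e'\<in>V. compatible c e e'}"
  obtain f where f: "\<And>y. \<bar>f \<bullet> y\<bar> \<le> A * N y" "\<And>h. h \<noteq> 0 \<Longrightarrow> c h \<in> V' \<Longrightarrow> N h \<le> 4 * (f \<bullet> h)"
    using cone[of V'] by (auto simp: V'_def)
  \<comment> \<open>This is the threshold in \<open>high\<close>. Being at least 3 keeps the size of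
    a block from doubling when one step is added.\<close>
  define C2 where "C2 = 4 * real K * C1 + 2 * real K + 3"
  have C2: "3 \<le> C2" using C1_nonneg by (simp add: C2_def)
  \<comment> \<open>The factor in \<open>far\<close>. The family is scattered with
    \<open>2 * M\<close>, since a block extended by one step may have almost twice the size.\<close>
  define M where "M = 4 + 16 * A"
  obtain C3 where C3: "0 \<le> C3"
    "\<And>S x t \<phi> D. scattered (1 / 8) (A + 1) (2 * M) D S x t \<phi> \<Longrightarrow> sum t S \<le> C3 * D"
  proof -
    have "0 < (1 / 8 :: real)" "1 / 8 \<le> A + 1" "1 \<le> 2 * M" using A by (auto simp: M_def)
    then show thesis using sum_scales_bound that by blast
  qed
  show ?case
  proof (intro exI[of _ "2 * C2 * C3"] conjI allI impI)
    show "0 \<le> 2 * C2 * C3" using C2 C3(1) by simp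
    fix xs assume xs: "xs \<noteq> []" "contracted N xs" "sorted_wrt (\<lambda>x y. y \<noteq> x \<longrightarrow> c (y - x) \<in> V) xs"
    define m where "m = length xs - 1"
    have len: "length xs = Suc m" using xs(1) by (simp add: m_def)
    define d where "d i j = N (xs ! j - xs ! i)" for i j
    define s where "s l = N (xs ! Suc l - xs ! l)" for l
    have d2: "d p q \<le> 2 * d i j" if "i \<le> p" "p \<le> q" "q \<le> j" "j \<le> m" for i p q j
      unfolding d_def using that len by (intro contracted_le_twice[OF xs(2)]) auto
    have d0: "0 \<le> d i j" for i j by (simp add: d_def)
    \<comment> \<open>The largest admissible end, not the one before the first failure: every
      \<open>j\<close> beyond \<open>e i\<close> then gives a long block. \<open>Suc i\<close> is
      always admissible.\<close>
    define e where "e i = Max {j \<in> {i<..m}. sum s {i..<j} \<le> C2 * d i j}" for i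
    have e: "i < e i \<and> e i \<le> m \<and> sum s {i..<e i} \<le> C2 * d i (e i)" if "i < m" for i
    proof -
      have "sum s {i..<Suc i} \<le> C2 * d i (Suc i)"
        using C2 d0[of i "Suc i"] mult_right_mono[of 1 C2 "d i (Suc i)"] by (simp add: s_def d_def)
      then have "Suc i \<in> {j \<in> {i<..m}. sum s {i..<j} \<le> C2 * d i j}" using that by simp
      then have "e i \<in> {j \<in> {i<..m}. sum s {i..<j} \<le> C2 * d i j}"
        unfolding e_def by (intro Max_in) auto
      then show ?thesis by simp
    qed
    have beyond: "C2 * d i j < sum s {i..<j}" if "i < m" "e i < j" "j \<le> m" for i j
    proof (rule ccontr)
      assume "\<not> ?thesis"
      then have "j \<in> {j \<in> {i<..m}. sum s {i..<j} \<le> C2 * d i j}" using that e[of i] by auto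
      then have "j \<le> e i" unfolding e_def by (intro Max_ge) auto
      then show False using that by simp
    qed
    define t where "t i = d i (e i)" for i
    obtain S where S: "S \<subseteq> {0..<m}" "sum s {0..<m} \<le> C2 * sum t S"
        "\<And>a b. a \<in> S \<Longrightarrow> b \<in> S \<Longrightarrow> a < b \<Longrightarrow> e a \<le> b"
      using greedy_blocks[of m e s C2 t 0] e by (auto simp: t_def)
    have "scattered (1 / 8) (A + 1) (2 * M) (2 * d 0 m) S (\<lambda>a. xs ! a) t (\<lambda>a. f \<bullet> xs ! a)"
      unfolding scattered_def
    proof (intro conjI ballI impI)
      show "finite S" using S(1) finite_subset by blast
      show "0 \<le> 2 * d 0 m" using d0 by simp
      fix a b assume ab: "a \<in> S" "b \<in> S"
      then have abm: "a < m" "b < m" using S(1) by auto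
      show "0 \<le> t a" by (simp add: t_def d0)
      show "t a \<le> 2 * d 0 m" unfolding t_def using e[OF abm(1)] by (intro d2) auto
      have "N (xs ! b - xs ! a) \<le> 2 * N (xs ! m - xs ! 0)"
        using abm len by (intro contracted_le_twice[OF xs(2)]) auto
      then show "N (xs ! b - xs ! a) \<le> 2 * d 0 m" by (simp add: d_def)
      show "\<bar>f \<bullet> xs ! b - f \<bullet> xs ! a\<bar> \<le> (A + 1) * N (xs ! b - xs ! a)"
        using f(1)[of "xs ! b - xs ! a"] nonneg[of "xs ! b - xs ! a"]
        by (simp add: inner_diff_right algebra_simps del: nonneg)
      show "N (xs ! b - xs ! a) \<le> N (xs ! b - xs ! j)" if "j \<in> S" "j \<le> a" "a < b" for j
        using contractedD[OF xs(2), of j a b] that abm len by simp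
      show "t a \<le> 2 * N (xs ! b - xs ! j)" if j: "j \<in> S" "j \<le> a" "a < b" for j
        unfolding t_def d_def[of j b, symmetric]
        using j S(3)[OF ab j(3)] e[OF abm(1)] abm by (intro d2) auto
      assume lt: "a < b" and far: "(2 * M) * t a \<le> N (xs ! b - xs ! a)"
      show "1 / 8 * N (xs ! b - xs ! a) \<le> f \<bullet> xs ! b - f \<bullet> xs ! a"
      \<comment> \<open>If \<open>b\<close> is the end of the block itself,
        \<open>N (xs ! b - xs ! a) = t a\<close>, and \<open>far\<close> forces
        \<open>t a = 0\<close>.\<close>
      proof (cases "b = e a")
        case True
        have "2 * t a \<le> (2 * M) * t a" using A d0[of a "e a"] by (intro mult_right_mono) (auto simp: M_def t_def)
        then have "d a b \<le> 0" using far True d0[of a b] by (simp add: t_def d_def)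
        then have "xs ! b = xs ! a" by (metis d_def not_less pos_iff right_minus_eq)
        then show ?thesis by simp
      next
        case False
        \<comment> \<open>One step past a maximal block the length exceeds
          \<open>C2 * d a j\<close>. The added step is at most \<open>d a j + t a\<close>, whence
          \<open>(C2 - 1) * d a j < (C2 + 1) * t a\<close> and so
          \<open>d a j < 2 * t a\<close>.\<close>
        define j where "j = Suc (e a)"
        have j: "e a < j" "j \<le> b" "j \<le> m" "a \<le> j" "a \<le> e a"
          using S(3)[OF ab lt] False e[OF abm(1)] abm by (auto simp: j_def)
        have "C2 * d a j < sum s {a..<j}" using beyond abm j by simp
        also have "\<dots> = sum s {a..<e a} + d (e a) j" using j by (simp add: j_def s_def d_def)
        also have "\<dots> \<le> C2 * t a + (d a j + t a)"
          using e[OF abm(1)] triangle_diff[of "xs ! j" "xs ! e a" "xs ! a"] commute[of "xs ! a" "xs ! e a"]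
          by (simp add: t_def d_def)
        finally have "(C2 - 1) * d a j < (C2 + 1) * t a" by (simp add: algebra_simps)
        also have "(C2 + 1) * t a \<le> (C2 - 1) * (2 * t a)"
          using mult_right_mono[OF C2 d0[of a "e a"]] by (simp add: t_def algebra_simps)
        finally have "d a j < 2 * t a" using C2 by (simp add: mult_less_cancel_left_pos)
        then have "M * d a j \<le> M * (2 * t a)" using A by (intro mult_left_mono) (auto simp: M_def)
        then have far_j: "M * d a j \<le> N (xs ! b - xs ! a)" using far by simp
        have "N (xs ! b - xs ! a) \<le> 8 * (f \<bullet> (xs ! b - xs ! a))"
        proof (rule later_points_in_cone[OF xs(2,3) c C1_nonneg A low f(1), where j = j])
          show "N h \<le> 4 * (f \<bullet> h)" if "h \<noteq> 0" "c h \<in> V" "\<forall>e'\<in>V. compatible c (c h) e'" for h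
            using that by (intro f(2)) (auto simp: V'_def)
          show "(4 * real K * C1 + 2 * real K + 3) * N (xs ! j - xs ! a) < (\<Sum>l = a..<j. N (xs ! Suc l - xs ! l))"
            using \<open>C2 * d a j < sum s {a..<j}\<close> unfolding C2_def d_def s_def[abs_def] .
        qed (use abm j len far_j in \<open>auto simp: M_def d_def\<close>)
        then show ?thesis by (simp add: inner_diff_right)
      qed
    qed
    then have "sum t S \<le> C3 * (2 * d 0 m)" by (rule C3(2))
    then have "sum s {0..<m} \<le> C2 * (C3 * (2 * d 0 m))"
      using S(2) mult_left_mono[of "sum t S" "C3 * (2 * d 0 m)" C2] C2 by linarith
    moreover have "path_len N xs = sum s {0..<m}"
      by (simp add: path_len_nth m_def s_def atLeast0LessThan)
    ultimately show "path_len N xs \<le> 2 * C2 * C3 * N (last xs - hd xs)"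
      using xs(1) by (simp add: d_def m_def last_conv_nth hd_conv_nth algebra_simps)
  qed
qed

lemma path_len_contracted:
  obtains C where "0 \<le> C"
    "\<And>xs. \<lbrakk>xs \<noteq> []; contracted N xs\<rbrakk> \<Longrightarrow> path_len N xs \<le> C * N (last xs - hd xs)"
proof (rule cone_functional)
  fix c :: "'a \<Rightarrow> nat" and K A
  assume A: "0 \<le> A" and c: "\<And>w. c w < K"
    and cone: "\<And>S. \<lbrakk>\<And>e e'. e \<in> S \<Longrightarrow> e' \<in> S \<Longrightarrow> compatible c e e'\<rbrakk> \<Longrightarrow>
      \<exists>f. (\<forall>y. \<bar>f \<bullet> y\<bar> \<le> A * N y) \<and> (\<forall>h. h \<noteq> 0 \<longrightarrow> c h \<in> S \<longrightarrow> N h \<le> 4 * (f \<bullet> h))"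
  have "\<exists>C\<ge>0. \<forall>xs. xs \<noteq> [] \<longrightarrow> contracted N xs \<longrightarrow>
      sorted_wrt (\<lambda>x y. y \<noteq> x \<longrightarrow> c (y - x) \<in> {..<K}) xs \<longrightarrow> path_len N xs \<le> C * N (last xs - hd xs)"
    by (rule path_len_le_of_colours[OF A c cone finite_lessThan])
  moreover have "sorted_wrt (\<lambda>x y. y \<noteq> x \<longrightarrow> c (y - x) \<in> {..<K}) xs" for xs
    using c by (simp add: sorted_wrt_iff_nth_less)
  ultimately show thesis using that by blast
qed

end

section \<open>From finite sequences to curves\<close>

theorem theorem3p2:
  fixes N :: "real ^ 'n \<Rightarrow> real"
  assumes "is_norm N"
  shows "\<exists>C>0. \<forall>(I :: real set) (D :: (real ^ 'n) set) (\<theta> :: real \<Rightarrow> real ^ 'n).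
           is_interval I \<longrightarrow> bounded D \<longrightarrow> self_contracted N I \<theta> \<longrightarrow> \<theta> ` I \<subseteq> D \<longrightarrow>
           curve_length I \<theta> \<le> ennreal (C * diameter D)"
proof -
  interpret vector_norm N by standard (fact assms)
  obtain b where b: "0 < b" "\<And>x. norm x \<le> b * N x" by (fact lower_bound)
  obtain B where B: "0 < B" "\<And>x. N x \<le> B * norm x" by (fact upper_bound)
  obtain C where C: "0 \<le> C"
    "\<And>xs. \<lbrakk>xs \<noteq> []; contracted N xs\<rbrakk> \<Longrightarrow> path_len N xs \<le> C * N (last xs - hd xs)"
    by (fact path_len_contracted)
  show ?thesis
  \<comment> \<open>\<open>b\<close> and \<open>B\<close> translate between the Euclidean norm and
    \<open>N\<close> at the two ends of the estimate; the summand 1 keeps the constant positive when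
    \<open>C\<close> is 0.\<close>
  proof (intro exI[of _ "b * C * B + 1"] conjI allI impI)
    show "0 < b * C * B + 1" using b B C(1) by (simp add: add_nonneg_pos)
    fix I :: "real set" and D :: "(real ^ 'n) set" and \<theta> :: "real \<Rightarrow> real ^ 'n"
    assume D: "bounded D" and \<theta>: "self_contracted N I \<theta>" "\<theta> ` I \<subseteq> D"
    have diam: "0 \<le> diameter D" using D by (rule diameter_ge_0)
    have "(\<Sum>j = 1..<m. norm (\<theta> (t (Suc j)) - \<theta> (t j))) \<le> (b * C * B + 1) * diameter D"
      if t: "\<forall>j\<in>{1..m}. t j \<in> I" "mono_on {1..m} t" for m and t :: "nat \<Rightarrow> real"
    proof (cases "m = 0")
      case False
      \<comment> \<open>Sample points are numbered from 1 and list positions from 0, hence the shift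
        by \<open>Suc\<close> below.\<close>
      define xs where "xs = map (\<lambda>j. \<theta> (t j)) [1..<Suc m]"
      have len: "length xs = m" by (simp add: xs_def)
      have nth: "xs ! i = \<theta> (t (Suc i))" if "i < m" for i
        using that unfolding xs_def by (subst nth_map) (auto simp del: upt_Suc)
      have ne: "xs \<noteq> []" using len False by auto
      have "contracted N xs"
        unfolding contracted_iff_nth
      proof (intro allI impI)
        fix i j k assume *: "i < j" "j < k" "k < length xs"
        then have "t (Suc i) \<in> I" "t (Suc j) \<in> I" "t (Suc k) \<in> I" using t(1) len by auto
        moreover have "t (Suc i) \<le> t (Suc j)" "t (Suc j) \<le> t (Suc k)"
          using * len by (auto intro!: mono_onD[OF t(2)])
        ultimately show "N (xs ! k - xs ! j) \<le> N (xs ! k - xs ! i)"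
          using \<theta>(1) * len by (auto simp: self_contracted_def nth)
      qed
      then have path: "path_len N xs \<le> C * N (last xs - hd xs)" using C(2) ne by blast
      have "last xs \<in> D" "hd xs \<in> D"
      proof -
        have "set xs \<subseteq> D" using t(1) \<theta>(2) by (auto simp: xs_def)
        then show "last xs \<in> D" "hd xs \<in> D" using ne by auto
      qed
      then have "norm (last xs - hd xs) \<le> diameter D"
        using diameter_bounded_bound[OF D, of "last xs" "hd xs"] by (simp add: dist_norm)
      then have "N (last xs - hd xs) \<le> B * diameter D"
        using B(2)[of "last xs - hd xs"] mult_left_mono[of "norm (last xs - hd xs)" "diameter D" B] B(1)
        by linarith
      then have "path_len N xs \<le> C * (B * diameter D)"
        using path mult_left_mono[OF _ C(1)] by (meson order_trans)
      moreover have "(\<Sum>j = 1..<m. norm (\<theta> (t (Suc j)) - \<theta> (t j))) \<le> b * path_len N xs"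
      proof -
        have "(\<Sum>j = 1..<m. norm (\<theta> (t (Suc j)) - \<theta> (t j)))
            = (\<Sum>i<m - 1. norm (xs ! Suc i - xs ! i))"
          unfolding sum.atLeastLessThan_shift_0[of _ 1 m]
          by (intro sum.cong) (auto simp: nth)
        also have "\<dots> \<le> (\<Sum>i<m - 1. b * N (xs ! Suc i - xs ! i))" by (intro sum_mono b(2))
        finally show ?thesis by (simp add: path_len_nth len sum_distrib_left)
      qed
      ultimately have "(\<Sum>j = 1..<m. norm (\<theta> (t (Suc j)) - \<theta> (t j))) \<le> b * (C * (B * diameter D))"
        using mult_left_mono[of "path_len N xs" _ b] b(1) by (meson less_imp_le order_trans)
      then show ?thesis using diam by (simp add: algebra_simps)
    next
      case True
      then show ?thesis using b B C(1) diam by simp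
    qed
    then show "curve_length I \<theta> \<le> ennreal ((b * C * B + 1) * diameter D)"
      unfolding curve_length_def by (intro Sup_least) (auto intro!: ennreal_leI)
  qed
qed

end
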